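(* Let $X=G$ be a non-abelian group with the binary operation $x*y=y^{-1}xy$. Then, for $n\geq 1$, each of the following pairs of maps $R_1,R_2:G\times G\to G$ yields an oriented singquandle structure $(X,*,R_1,R_2)$ on $G$: (1) $R_1(x,y)=x(xy^{-1})^{n}$ and $R_2(x,y)=y(x^{-1}y)^n$; (2) $R_1(x,y)=(xy^{-1})^nx$ and $R_2(x,y)=(x^{-1}y)^ny$; (3) $R_1(x,y)=x(yx^{-1})^{n+1}$ and $R_2(x,y)=x(y^{-1}x)^n$. Furthermore, in each of the cases (1), (2) and (3), different values of $n$ give non-isomorphic oriented singquandles.
   Context: A quandle is a set $X$ with a binary operation $*$ such that (1) $a*a=a$ for all $a\in X$; (2) for all $a,b\in X$ there is a unique $x\in X$ with $a=x*b$; (3) $(a*b)*c=(a*c)*(b*c)$ for all $a,b,c\in X$. The inverse operation $\bar{*}$ is defined by $(x*y)\,\bar{*}\,y=x=(x\,\bar{*}\,y)*y$. An oriented singquandle is a quadruple $(X,*,R_1,R_2)$ where $(X,* )$ is a quandle and $R_1,R_2:X\times X\to X$ are maps satisfying, for all $x,y,z\in X$: $$R_1(x\bar{*}y,z)*y=R_1(x,z*y),$$ $$R_2(x\bar{*}y,z)=R_2(x,z*y)\bar{*}y,$$ $$(y\bar{*}R_1(x,z))*x=(y*R_2(x,z))\bar{*}z,$$ $$R_2(x,y)=R_1(y,x*y),$$ $$R_1(x,y)*R_2(x,y)=R_2(y,x*y).$$ Two oriented singquandles $(X,*,R_1,R_2)$ and $(Y,\triangleright,S_1,S_2)$ are isomorphic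 if there is a bijection $f:X\to Y$ with $f(x*y)=f(x)\triangleright f(y)$, $f(R_1(x,y))=S_1(f(x),f(y))$ and $f(R_2(x,y))=S_2(f(x),f(y))$ for all $x,y\in X$.
   Formalization: The non-isomorphism claim is stated only for groups G without finite exponent (no e>0 with x^e=1 for all x); if such e exists, n and n+e give the same maps, so the claim as written fails for every such G (e.g. S_3 with n=1 and n=7). *)

theory Defs
  imports "HOL-Algebra.Group"
begin

locale quandle =
  fixes X :: "'a set" and star :: "'a \<Rightarrow> 'a \<Rightarrow> 'a" (infixl "\<star>" 70)
  assumes star_closed: "\<lbrakk>a \<in> X; b \<in> X\<rbrakk> \<Longrightarrow> a \<star> b \<in> X"
    and idem: "a \<in> X \<Longrightarrow> a \<star> a = a"
    and unique_solution: "\<lbrakk>a \<in> X; b \<in> X\<rbrakk> \<Longrightarrow> \<exists>!x. x \<in> X \<and> a = x \<star> b"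
    and right_distrib:
      "\<lbrakk>a \<in> X; b \<in> X; c \<in> X\<rbrakk> \<Longrightarrow> (a \<star> b) \<star> c = (a \<star> c) \<star> (b \<star> c)"
begin

definition star_bar :: "'a \<Rightarrow> 'a \<Rightarrow> 'a" (infixl "\<star>\<^sup>-" 70)
  where "x \<star>\<^sup>- y = (THE z. z \<in> X \<and> x = z \<star> y)"

lemma star_bar_closed: "\<lbrakk>x \<in> X; y \<in> X\<rbrakk> \<Longrightarrow> x \<star>\<^sup>- y \<in> X"
  and star_bar_star: "\<lbrakk>x \<in> X; y \<in> X\<rbrakk> \<Longrightarrow> (x \<star>\<^sup>- y) \<star> y = x"
  using theI'[OF unique_solution, of x y] by (auto simp: star_bar_def)

lemma star_star_bar:
  assumes "x \<in> X" "y \<in> X"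
  shows "(x \<star> y) \<star>\<^sup>- y = x"
  using unique_solution[OF star_closed[OF assms] assms(2)] assms
    star_bar_closed[OF star_closed[OF assms] assms(2)]
    star_bar_star[OF star_closed[OF assms] assms(2)] by metis

end

locale oriented_singquandle = quandle X star
  for X :: "'a set" and star :: "'a \<Rightarrow> 'a \<Rightarrow> 'a" (infixl "\<star>" 70) +
  fixes R1 R2 :: "'a \<Rightarrow> 'a \<Rightarrow> 'a"
  assumes R1_closed: "\<lbrakk>x \<in> X; y \<in> X\<rbrakk> \<Longrightarrow> R1 x y \<in> X"
    and R2_closed: "\<lbrakk>x \<in> X; y \<in> X\<rbrakk> \<Longrightarrow> R2 x y \<in> X"
    and R1_star: "\<lbrakk>x \<in> X; y \<in> X; z \<in> X\<rbrakk> \<Longrightarrow>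
          R1 (x \<star>\<^sup>- y) z \<star> y = R1 x (z \<star> y)"
    and R2_star: "\<lbrakk>x \<in> X; y \<in> X; z \<in> X\<rbrakk> \<Longrightarrow>
          R2 (x \<star>\<^sup>- y) z = R2 x (z \<star> y) \<star>\<^sup>- y"
    and star_R1_R2: "\<lbrakk>x \<in> X; y \<in> X; z \<in> X\<rbrakk> \<Longrightarrow>
          (y \<star>\<^sup>- R1 x z) \<star> x = (y \<star> R2 x z) \<star>\<^sup>- z"
    and R2_eq_R1: "\<lbrakk>x \<in> X; y \<in> X\<rbrakk> \<Longrightarrow> R2 x y = R1 y (x \<star> y)"
    and R1_star_R2: "\<lbrakk>x \<in> X; y \<in> X\<rbrakk> \<Longrightarrow> R1 x y \<star> R2 x y = R2 y (x \<star> y)"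

definition singquandle_isomorphic ::
  "'a set \<Rightarrow> ('a \<Rightarrow> 'a \<Rightarrow> 'a) \<Rightarrow> ('a \<Rightarrow> 'a \<Rightarrow> 'a) \<Rightarrow> ('a \<Rightarrow> 'a \<Rightarrow> 'a) \<Rightarrow>
   'b set \<Rightarrow> ('b \<Rightarrow> 'b \<Rightarrow> 'b) \<Rightarrow> ('b \<Rightarrow> 'b \<Rightarrow> 'b) \<Rightarrow> ('b \<Rightarrow> 'b \<Rightarrow> 'b) \<Rightarrow> bool"
  where "singquandle_isomorphic X star R1 R2 Y star' S1 S2 \<longleftrightarrow>
    (\<exists>f. bij_betw f X Y \<and>
      (\<forall>x\<in>X. \<forall>y\<in>X. f (star x y) = star' (f x) (f y) \<and>
        f (R1 x y) = S1 (f x) (f y) \<and> f (R2 x y) = S2 (f x) (f y)))"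

context
  fixes G :: "('a, 'b) monoid_scheme" (structure)
begin

definition conj_op :: "'a \<Rightarrow> 'a \<Rightarrow> 'a"
  where "conj_op x y = inv y \<otimes> x \<otimes> y"

definition R1_i :: "nat \<Rightarrow> 'a \<Rightarrow> 'a \<Rightarrow> 'a"
  where "R1_i n x y = x \<otimes> (x \<otimes> inv y) [^] n"

definition R2_i :: "nat \<Rightarrow> 'a \<Rightarrow> 'a \<Rightarrow> 'a"
  where "R2_i n x y = y \<otimes> (inv x \<otimes> y) [^] n"

definition R1_ii :: "nat \<Rightarrow> 'a \<Rightarrow> 'a \<Rightarrow> 'a"
  where "R1_ii n x y = (x \<otimes> inv y) [^] n \<otimes> x"

definition R2_ii :: "nat \<Rightarrow> 'a \<Rightarrow> 'a \<Rightarrow> 'a"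
  where "R2_ii n x y = (inv x \<otimes> y) [^] n \<otimes> y"

definition R1_iii :: "nat \<Rightarrow> 'a \<Rightarrow> 'a \<Rightarrow> 'a"
  where "R1_iii n x y = x \<otimes> (y \<otimes> inv x) [^] (n + 1)"

definition R2_iii :: "nat \<Rightarrow> 'a \<Rightarrow> 'a \<Rightarrow> 'a"
  where "R2_iii n x y = x \<otimes> (inv y \<otimes> x) [^] n"

end

definition finite_exponent :: "('a, 'b) monoid_scheme \<Rightarrow> bool"
  where "finite_exponent G \<longleftrightarrow> (\<exists>e::nat. e > 0 \<and> (\<forall>x\<in>carrier G. x [^]\<^bsub>G\<^esub> e = \<one>\<^bsub>G\<^esub>))"

text \<open>
  If \<open>G\<close> has finite exponent \<open>e\<close>, then replacing \<open>n\<close> by \<open>n + e\<close> does not change the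
  maps at all. Hence different values of \<open>n\<close> can give pairwise non-isomorphic
  structures on \<open>G\<close> only if \<open>G\<close> does not have finite exponent.
\<close>

lemma (in group) finite_exponent_imp_isomorphic:
  assumes "finite_exponent G"
  shows "\<exists>m n. 1 \<le> m \<and> 1 \<le> n \<and> m \<noteq> n \<and>
    singquandle_isomorphic
      (carrier G) (conj_op G) (R1_i G m) (R2_i G m)
      (carrier G) (conj_op G) (R1_i G n) (R2_i G n) \<and>
    singquandle_isomorphic
      (carrier G) (conj_op G) (R1_ii G m) (R2_ii G m)
      (carrier G) (conj_op G) (R1_ii G n) (R2_ii G n) \<and>
    singquandle_isomorphic
      (carrier G) (conj_op G) (R1_iii G m) (R2_iii G m)
      (carrier G) (conj_op G) (R1_iii G n) (R2_iii G n)"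
proof -
  obtain e :: nat where e: "e > 0" "\<And>x. x \<in> carrier G \<Longrightarrow> x [^] e = \<one>"
    using assms unfolding finite_exponent_def by blast
  show ?thesis
    unfolding singquandle_isomorphic_def
    by (rule exI[of _ "1::nat"], rule exI[of _ "Suc e"], intro conjI exI[of _ id])
      (use e in \<open>auto simp: R1_i_def R2_i_def R1_ii_def R2_ii_def R1_iii_def R2_iii_def\<close>)
qed

end

theory Submission
  imports Defs
begin

text \<open>
  In all three cases \<open>R1\<close> commutes with conjugation, \<open>R1 x y \<otimes> R2 x y = x \<otimes> y\<close> and
  \<open>R2 x y = R1 y (x * y)\<close>. These three facts imply all axioms of an oriented singquandle;
  the last one uses that conjugation by \<open>x \<otimes> y\<close> takes \<open>x\<close> to \<open>x * y\<close> and \<open>y\<close> to \<open>y * (x * y)\<close>.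

  On commuting arguments \<open>R1\<close> (in the third case \<open>R2\<close>) is \<open>x\<^sup>n\<^sup>+\<^sup>1 y\<^sup>-\<^sup>n\<close>. An isomorphism \<open>f\<close>
  from parameter \<open>m\<close> to parameter \<open>n\<close> sends the identity to a central element, and a central
  translation makes it fix the identity. Then \<open>\<phi>(a) = f(x\<^sup>a)\<close> satisfies
  \<open>\<phi>((m + 1)a - mb) = \<phi>(a)\<^sup>n\<^sup>+\<^sup>1 \<phi>(b)\<^sup>-\<^sup>n\<close>, and two evaluations of \<open>\<phi>(-m(m + 1))\<^sup>-\<^sup>n\<close> give
  \<open>f(x)\<^bsup>mn(n+1)\<^esup> = f(x)\<^bsup>nn(n+1)\<^esup>\<close>. So \<open>m \<noteq> n\<close> forces finite exponent.
\<close>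

context group
begin

section \<open>Powers and conjugation in a group\<close>

lemma mult_inv_cancel:
  assumes "x \<in> carrier G" "y \<in> carrier G"
  shows "x \<otimes> (inv x \<otimes> y) = y" "inv x \<otimes> (x \<otimes> y) = y"
  using assms by (simp_all flip: m_assoc)

text \<open>Moving the outer factor across a power makes the powers in
  \<open>R1 x y \<otimes> R2 x y\<close> adjacent, where they cancel.\<close>

lemma pow_shift:
  assumes "x \<in> carrier G" "w \<in> carrier G"
  shows "x \<otimes> (w \<otimes> x) [^] (n::nat) = (x \<otimes> w) [^] n \<otimes> x"
  using assms by (induction n) (simp_all flip: m_assoc)

lemma pow_mult_inv_pow:
  assumes "a \<in> carrier G"
  shows "a [^] (n::nat) \<otimes> (inv a) [^] n = \<one>"
  using assms by (simp add: nat_pow_inv)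

lemma conj_op_closed [simp]:
  "\<lbrakk>x \<in> carrier G; y \<in> carrier G\<rbrakk> \<Longrightarrow> conj_op G x y \<in> carrier G"
  by (simp add: conj_op_def)

lemma conj_op_mult:
  assumes "x \<in> carrier G" "y \<in> carrier G" "g \<in> carrier G"
  shows "conj_op G (x \<otimes> y) g = conj_op G x g \<otimes> conj_op G y g"
  using assms by (simp add: conj_op_def m_assoc mult_inv_cancel)

lemma conj_op_one: "g \<in> carrier G \<Longrightarrow> conj_op G \<one> g = \<one>"
  by (simp add: conj_op_def)

lemma conj_op_inv:
  assumes "x \<in> carrier G" "g \<in> carrier G"
  shows "conj_op G (inv x) g = inv (conj_op G x g)"
  using assms by (simp add: conj_op_def inv_mult_group m_assoc)

lemma conj_op_pow:
  assumes "x \<in> carrier G" "g \<in> carrier G"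
  shows "conj_op G (x [^] (n::nat)) g = conj_op G x g [^] n"
  using assms by (induction n) (simp_all add: conj_op_one conj_op_mult)

lemma conj_op_conj_op:
  assumes "x \<in> carrier G" "g \<in> carrier G" "h \<in> carrier G"
  shows "conj_op G (conj_op G x g) h = conj_op G x (g \<otimes> h)"
  using assms by (simp add: conj_op_def inv_mult_group m_assoc)

lemma conj_op_by_one: "x \<in> carrier G \<Longrightarrow> conj_op G x \<one> = x"
  by (simp add: conj_op_def)

lemma conj_op_eq_iff_commute:
  assumes "x \<in> carrier G" "y \<in> carrier G"
  shows "conj_op G x y = x \<longleftrightarrow> x \<otimes> y = y \<otimes> x"
proof -
  have "conj_op G x y = x \<longleftrightarrow> y \<otimes> (inv y \<otimes> (x \<otimes> y)) = y \<otimes> x"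
    using assms by (simp add: conj_op_def m_assoc)
  then show ?thesis
    using assms by (simp add: mult_inv_cancel)
qed

section \<open>The conjugation quandle and its oriented singquandle structures\<close>

lemma quandle_conj_op: "quandle (carrier G) (conj_op G)"
proof
  fix a b assume ab: "a \<in> carrier G" "b \<in> carrier G"
  show "\<exists>!x. x \<in> carrier G \<and> a = conj_op G x b"
  proof (intro ex1I[of _ "conj_op G a (inv b)"] conjI)
    fix x assume "x \<in> carrier G \<and> a = conj_op G x b"
    then show "x = conj_op G a (inv b)"
      using ab by (simp add: conj_op_conj_op conj_op_by_one)
  qed (use ab in \<open>simp_all add: conj_op_conj_op conj_op_by_one\<close>)
next
  fix a b c assume "a \<in> carrier G" "b \<in> carrier G" "c \<in> carrier G"
  then show "conj_op G (conj_op G a b) c = conj_op G (conj_op G a c) (conj_op G b c)"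
    by (simp add: conj_op_def inv_mult_group m_assoc mult_inv_cancel)
qed (simp_all add: conj_op_def)

lemma star_bar_conj_op:
  assumes "x \<in> carrier G" "y \<in> carrier G"
  shows "quandle.star_bar (carrier G) (conj_op G) x y = conj_op G x (inv y)"
proof -
  interpret Q: quandle "carrier G" "conj_op G" by (rule quandle_conj_op)
  \<comment> \<open>Conjugation by \<open>y\<close> takes \<open>conj_op G x (inv y)\<close> back to
    \<open>x\<close>, so \<open>star_star_bar\<close> gives the value without unfolding the definite
    description.\<close>
  have "Q.star_bar (conj_op G (conj_op G x (inv y)) y) y = conj_op G x (inv y)"
    using assms by (intro Q.star_star_bar) simp_all
  then show ?thesis
    using assms by (simp add: conj_op_conj_op conj_op_by_one)
qed

text \<open>By \<open>equivariant\<close> and \<open>R2\<close> the first two axioms become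
  identities between iterated conjugations. The third follows from \<open>prod\<close>, the fourth
  is \<open>R2\<close>, and the fifth combines all three.\<close>

lemma oriented_singquandle_conj_opI:
  assumes closed: "\<And>x y. \<lbrakk>x \<in> carrier G; y \<in> carrier G\<rbrakk> \<Longrightarrow> R1 x y \<in> carrier G"
    and equivariant: "\<And>x y g. \<lbrakk>x \<in> carrier G; y \<in> carrier G; g \<in> carrier G\<rbrakk> \<Longrightarrow>
      conj_op G (R1 x y) g = R1 (conj_op G x g) (conj_op G y g)"
    and R2: "\<And>x y. \<lbrakk>x \<in> carrier G; y \<in> carrier G\<rbrakk> \<Longrightarrow> R2 x y = R1 y (conj_op G x y)"
    and prod: "\<And>x y. \<lbrakk>x \<in> carrier G; y \<in> carrier G\<rbrakk> \<Longrightarrow> R1 x y \<otimes> R2 x y = x \<otimes> y"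
  shows "oriented_singquandle (carrier G) (conj_op G) R1 R2"
proof -
  interpret Q: quandle "carrier G" "conj_op G" by (rule quandle_conj_op)
  have R2_closed: "R2 x y \<in> carrier G" if "x \<in> carrier G" "y \<in> carrier G" for x y
    using that by (simp add: R2 closed)
  show ?thesis
  proof
    fix x y z assume [simp]: "x \<in> carrier G" "y \<in> carrier G" "z \<in> carrier G"
    show "conj_op G (R1 (Q.star_bar x y) z) y = R1 x (conj_op G z y)"
      by (simp add: star_bar_conj_op equivariant conj_op_conj_op conj_op_by_one)
    \<comment> \<open>Both sides reduce to
      \<open>R1 z (conj_op G x (inv y \<otimes> z))\<close>.\<close>
    show "R2 (Q.star_bar x y) z = Q.star_bar (R2 x (conj_op G z y)) y"
      by (simp add: star_bar_conj_op R2 closed equivariant conj_op_conj_op conj_op_by_one)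
        (simp add: conj_op_def m_assoc)
    \<comment> \<open>The two sides of the third axiom conjugate \<open>y\<close> by
      \<open>inv (R1 x z) \<otimes> x\<close> and by \<open>R2 x z \<otimes> inv z\<close>.\<close>
    have "inv (R1 x z) \<otimes> x = inv (R1 x z) \<otimes> (x \<otimes> z) \<otimes> inv z"
      by (simp add: closed m_assoc)
    also have "\<dots> = R2 x z \<otimes> inv z"
      by (subst prod[of x z, symmetric]) (simp_all add: closed R2_closed mult_inv_cancel)
    finally show "conj_op G (Q.star_bar y (R1 x z)) x = Q.star_bar (conj_op G y (R2 x z)) z"
      by (simp add: star_bar_conj_op closed R2_closed conj_op_conj_op)
  next
    fix x y assume [simp]: "x \<in> carrier G" "y \<in> carrier G"
    have "R2 y (conj_op G x y) = R1 (conj_op G x y) (conj_op G y (conj_op G x y))"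
      by (simp add: R2)
    also have "\<dots> = R1 (conj_op G x (x \<otimes> y)) (conj_op G y (x \<otimes> y))"
      by (simp add: conj_op_def inv_mult_group m_assoc mult_inv_cancel)
    also have "\<dots> = conj_op G (R1 x y) (R1 x y \<otimes> R2 x y)"
      by (simp add: equivariant prod)
    \<comment> \<open>Conjugating first by \<open>R1 x y\<close> itself does nothing, by
      idempotence.\<close>
    also have "\<dots> = conj_op G (R1 x y) (R2 x y)"
      by (simp add: closed R2_closed Q.idem flip: conj_op_conj_op)
    finally show "conj_op G (R1 x y) (R2 x y) = R2 y (conj_op G x y)" by simp
  qed (simp_all add: closed R2)
qed

lemma oriented_singquandle_i:
  "oriented_singquandle (carrier G) (conj_op G) (R1_i G n) (R2_i G n)"
proof (rule oriented_singquandle_conj_opI)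
  fix x y assume [simp]: "x \<in> carrier G" "y \<in> carrier G"
  show "R2_i G n x y = R1_i G n y (conj_op G x y)"
    by (simp add: R2_i_def R1_i_def conj_op_def inv_mult_group m_assoc mult_inv_cancel)
  have "R1_i G n x y \<otimes> R2_i G n x y
      = x \<otimes> (x \<otimes> inv y) [^] n \<otimes> ((y \<otimes> inv x) [^] n \<otimes> y)"
    by (simp add: R1_i_def R2_i_def pow_shift)
  also have "\<dots> = x \<otimes> ((x \<otimes> inv y) [^] n \<otimes> (inv (x \<otimes> inv y)) [^] n) \<otimes> y"
    by (simp add: inv_mult_group m_assoc)
  also have "\<dots> = x \<otimes> y"
    by (subst pow_mult_inv_pow) simp_all
  finally show "R1_i G n x y \<otimes> R2_i G n x y = x \<otimes> y" .
qed (simp_all add: R1_i_def conj_op_mult conj_op_pow conj_op_inv)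

lemma oriented_singquandle_ii:
  "oriented_singquandle (carrier G) (conj_op G) (R1_ii G n) (R2_ii G n)"
proof (rule oriented_singquandle_conj_opI)
  fix x y assume [simp]: "x \<in> carrier G" "y \<in> carrier G"
  show "R2_ii G n x y = R1_ii G n y (conj_op G x y)"
    by (simp add: R2_ii_def R1_ii_def conj_op_def inv_mult_group m_assoc mult_inv_cancel)
  have "R1_ii G n x y \<otimes> R2_ii G n x y
      = x \<otimes> (inv y \<otimes> x) [^] n \<otimes> ((inv x \<otimes> y) [^] n \<otimes> y)"
    by (simp add: R1_ii_def R2_ii_def pow_shift)
  also have "\<dots> = x \<otimes> ((inv y \<otimes> x) [^] n \<otimes> (inv (inv y \<otimes> x)) [^] n) \<otimes> y"
    by (simp add: inv_mult_group m_assoc)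
  also have "\<dots> = x \<otimes> y"
    by (subst pow_mult_inv_pow) simp_all
  finally show "R1_ii G n x y \<otimes> R2_ii G n x y = x \<otimes> y" .
qed (simp_all add: R1_ii_def conj_op_mult conj_op_pow conj_op_inv)

lemma oriented_singquandle_iii:
  "oriented_singquandle (carrier G) (conj_op G) (R1_iii G n) (R2_iii G n)"
proof (rule oriented_singquandle_conj_opI)
  fix x y assume [simp]: "x \<in> carrier G" "y \<in> carrier G"
  have "R1_iii G n y (conj_op G x y) = y \<otimes> (inv y \<otimes> x) [^] Suc n"
    by (simp add: R1_iii_def conj_op_def m_assoc del: nat_pow_Suc)
  \<comment> \<open>Splitting off the first factor turns the leading \<open>y\<close> into
    \<open>x\<close> and lowers the exponent to the \<open>n\<close> of
    \<open>R2_iii\<close>.\<close>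
  also have "\<dots> = y \<otimes> ((inv y \<otimes> x) \<otimes> (inv y \<otimes> x) [^] n)"
    by (subst nat_pow_Suc2) simp_all
  also have "\<dots> = R2_iii G n x y"
    by (simp add: R2_iii_def m_assoc mult_inv_cancel)
  finally show "R2_iii G n x y = R1_iii G n y (conj_op G x y)" by simp
  have "R1_iii G n x y \<otimes> R2_iii G n x y
      = x \<otimes> (y \<otimes> inv x) [^] Suc n \<otimes> ((x \<otimes> inv y) [^] n \<otimes> x)"
    by (simp add: R1_iii_def R2_iii_def pow_shift)
  also have "\<dots> = x \<otimes> (y \<otimes> inv x) \<otimes> ((y \<otimes> inv x) [^] n \<otimes> (inv (y \<otimes> inv x)) [^] n) \<otimes> x"
    by (subst nat_pow_Suc2) (simp_all add: inv_mult_group m_assoc)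
  also have "\<dots> = x \<otimes> y"
    by (subst pow_mult_inv_pow) (simp_all add: m_assoc)
  finally show "R1_iii G n x y \<otimes> R2_iii G n x y = x \<otimes> y" .
qed (simp_all add: R1_iii_def conj_op_mult conj_op_pow conj_op_inv del: nat_pow_Suc)

section \<open>Isomorphic structures and finite exponent\<close>

text \<open>With \<open>p = \<phi> 1\<close>, lowering \<open>b\<close> by \<open>m + 1\<close>
  multiplies \<open>inv (\<phi> b [^] n)\<close> by \<open>p [^] (n * (n + 1))\<close>. Thus
  \<open>m\<close> such moves from \<open>0\<close> give the left-hand side, while evaluating
  \<open>\<phi>\<close> at \<open>-(m + 1) * m\<close> directly gives the right-hand side.\<close>

lemma int_affine_pow_eq:
  fixes \<phi> :: "int \<Rightarrow> 'a" and m n :: nat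
  assumes closed: "\<And>a. \<phi> a \<in> carrier G"
    and zero: "\<phi> 0 = \<one>"
    and affine: "\<And>a b. \<phi> ((int m + 1) * a - int m * b) = \<phi> a [^] (n + 1) \<otimes> inv (\<phi> b [^] n)"
  shows "\<phi> 1 [^] (m * (n * (n + 1))) = \<phi> 1 [^] (n * (n * (n + 1)))"
proof -
  define p where "p = \<phi> 1"
  have p [simp]: "p \<in> carrier G" by (simp add: p_def closed)
  have neg: "\<phi> (- (int m * b)) = inv (\<phi> b [^] n)" for b
    using affine[of 0 b] by (simp add: zero closed)
  have scale: "\<phi> ((int m + 1) * a) = \<phi> a [^] (n + 1)" for a
    using affine[of a 0] by (simp add: zero closed)
  have pn: "\<phi> (- int m) = inv (p [^] n)"
    using neg[of 1] by (simp add: p_def)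
  have step: "inv (\<phi> (b + (int m + 1)) [^] n) = inv (p [^] (n * (n + 1))) \<otimes> inv (\<phi> b [^] n)" for b
  proof -
    \<comment> \<open>By \<open>neg\<close> this is a value of \<open>\<phi>\<close>; its argument
      has affine form with \<open>a = -m\<close>, so \<open>affine\<close> applies although
      \<open>\<phi>\<close> is not assumed additive.\<close>
    have "inv (\<phi> (b + (int m + 1)) [^] n) = \<phi> ((int m + 1) * (- int m) - int m * b)"
      by (simp add: algebra_simps flip: neg)
    also have "\<dots> = inv (p [^] n) [^] (n + 1) \<otimes> inv (\<phi> b [^] n)"
      by (simp only: affine pn)
    also have "inv (p [^] n) [^] (n + 1) = inv (p [^] (n * (n + 1)))"
      by (simp only: nat_pow_inv nat_pow_pow nat_pow_closed p)
    finally show ?thesis .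
  qed
  have iter: "inv (\<phi> (- ((int m + 1) * int k)) [^] n) = p [^] (k * (n * (n + 1)))" for k
  proof (induction k)
    case 0
    then show ?case by (simp add: zero)
  next
    case (Suc k)
    let ?b = "- ((int m + 1) * int (Suc k))"
    have "?b + (int m + 1) = - ((int m + 1) * int k)"
      by (simp add: algebra_simps)
    then have "p [^] (k * (n * (n + 1))) = inv (p [^] (n * (n + 1))) \<otimes> inv (\<phi> ?b [^] n)"
      using Suc step[of ?b] by simp
    then have "inv (\<phi> ?b [^] n) = p [^] (n * (n + 1)) \<otimes> p [^] (k * (n * (n + 1)))"
      using mult_inv_cancel(1)[of "p [^] (n * (n + 1))" "inv (\<phi> ?b [^] n)"] closed by simp
    then show ?case
      by (simp add: nat_pow_mult)
  qed
  have "\<phi> (- ((int m + 1) * int m)) = inv (p [^] n) [^] (n + 1)"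
    using scale[of "- int m"] by (simp add: pn)
  also have "\<dots> = inv (p [^] (n * (n + 1)))"
    by (simp only: nat_pow_inv nat_pow_pow nat_pow_closed p)
  finally have "p [^] (m * (n * (n + 1))) = inv (inv (p [^] (n * (n + 1))) [^] n)"
    using iter[of m] by simp
  also have "\<dots> = p [^] (n * (n * (n + 1)))"
    by (simp add: nat_pow_inv nat_pow_pow mult.commute)
  finally show ?thesis by (simp add: p_def)
qed

text \<open>The left sides are the forms of \<open>R1_i\<close>, \<open>R1_ii\<close> and
  \<open>R2_iii\<close>. On commuting arguments \<open>R1_iii\<close> instead gives \<open>y\<close>
  the exponent \<open>n + 1\<close> and \<open>x\<close> the exponent \<open>-n\<close>.\<close>

lemma commuting_mult_pow:
  assumes "x \<in> carrier G" "y \<in> carrier G" "x \<otimes> y = y \<otimes> x"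
  shows "x \<otimes> (x \<otimes> inv y) [^] (n::nat) = x [^] (n + 1) \<otimes> inv (y [^] n)"
    "(x \<otimes> inv y) [^] (n::nat) \<otimes> x = x [^] (n + 1) \<otimes> inv (y [^] n)"
    "x \<otimes> (inv y \<otimes> x) [^] (n::nat) = x [^] (n + 1) \<otimes> inv (y [^] n)"
proof -
  have c: "x \<otimes> inv y = inv y \<otimes> x"
    using assms by (metis inv_closed inv_solve_left inv_solve_right m_assoc m_closed)
  have pow: "(x \<otimes> inv y) [^] n = x [^] n \<otimes> inv (y [^] n)"
    using pow_mult_distrib[OF c] assms by (simp add: nat_pow_inv)
  show 1: "x \<otimes> (x \<otimes> inv y) [^] n = x [^] (n + 1) \<otimes> inv (y [^] n)"
    using assms nat_pow_Suc2[of x n] by (simp add: pow del: nat_pow_Suc flip: m_assoc)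
  then show "x \<otimes> (inv y \<otimes> x) [^] n = x [^] (n + 1) \<otimes> inv (y [^] n)"
    by (simp only: c)
  then show "(x \<otimes> inv y) [^] n \<otimes> x = x [^] (n + 1) \<otimes> inv (y [^] n)"
    using assms by (simp only: pow_shift inv_closed)
qed

text \<open>Commuting means \<open>conj_op G x y = x\<close>, so \<open>f\<close> preserves it;
  hence \<open>R_comm\<close> applies to powers of one element and \<open>S_comm\<close> to their
  images.\<close>

lemma finite_exponentI_conj_op_iso:
  fixes m n :: nat
  assumes bij: "bij_betw f (carrier G) (carrier G)"
    and conj: "\<And>x y. \<lbrakk>x \<in> carrier G; y \<in> carrier G\<rbrakk> \<Longrightarrow>
      f (conj_op G x y) = conj_op G (f x) (f y)"
    and R: "\<And>x y. \<lbrakk>x \<in> carrier G; y \<in> carrier G\<rbrakk> \<Longrightarrow> f (R x y) = S (f x) (f y)"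
    and R_comm: "\<And>x y. \<lbrakk>x \<in> carrier G; y \<in> carrier G; x \<otimes> y = y \<otimes> x\<rbrakk> \<Longrightarrow>
      R x y = x [^] (m + 1) \<otimes> inv (y [^] m)"
    and S_comm: "\<And>x y. \<lbrakk>x \<in> carrier G; y \<in> carrier G; x \<otimes> y = y \<otimes> x\<rbrakk> \<Longrightarrow>
      S x y = x [^] (n + 1) \<otimes> inv (y [^] n)"
    and n: "1 \<le> n" and mn: "m \<noteq> n"
  shows "finite_exponent G"
proof -
  have f_closed [simp]: "f x \<in> carrier G" if "x \<in> carrier G" for x
    using bij that by (auto simp: bij_betw_def)
  have f_comm: "f x \<otimes> f y = f y \<otimes> f x"
    if "x \<in> carrier G" "y \<in> carrier G" "x \<otimes> y = y \<otimes> x" for x y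
    using that conj[of x y] by (metis conj_op_eq_iff_commute f_closed)
  have surj: "\<exists>x\<in>carrier G. f x = g" if "g \<in> carrier G" for g
    using bij that by (force simp: bij_betw_def)
  define c where "c = f \<one>"
  have c [simp]: "c \<in> carrier G" by (simp add: c_def)
  have central: "g \<otimes> inv c = inv c \<otimes> g" if g: "g \<in> carrier G" for g
  proof -
    \<comment> \<open>Since \<open>\<one>\<close> commutes with every \<open>x\<close>,
      \<open>c\<close> commutes with every \<open>f x\<close>.\<close>
    obtain x where "x \<in> carrier G" "f x = g" using surj[OF g] by auto
    then have "g \<otimes> c = c \<otimes> g"
      using f_comm[of x \<one>] by (simp add: c_def)
    then show ?thesis
      using g by (metis c inv_closed inv_solve_left inv_solve_right m_assoc m_closed)
  qed
  have powers: "f x [^] k \<otimes> inv c [^] k = (f x \<otimes> inv c) [^] k"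
    if "x \<in> carrier G" for x and k :: nat
    using that pow_mult_distrib[OF central] by simp
  define E where "E = (n * (n + 1))"
  have eq: "g [^] (m * E) = g [^] (n * E)" if g: "g \<in> carrier G" for g
  proof -
    \<comment> \<open>The preimage of \<open>g \<otimes> c\<close> is taken so that
      \<open>\<phi> 1 = g\<close> after translation by \<open>inv c\<close>.\<close>
    obtain x where x [simp]: "x \<in> carrier G" and fx: "f x = g \<otimes> c"
      using surj[of "g \<otimes> c"] g by auto
    define \<phi> where "\<phi> = (\<lambda>a::int. f (x [^] a) \<otimes> inv c)"
    have \<phi>_closed [simp]: "\<phi> a \<in> carrier G" for a by (simp add: \<phi>_def)
    have affine: "\<phi> ((int m + 1) * a - int m * b) = \<phi> a [^] (n + 1) \<otimes> inv (\<phi> b [^] n)" for a b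
    proof -
      let ?u = "x [^] a" and ?v = "x [^] b"
      have uv: "?u \<otimes> ?v = ?v \<otimes> ?u"
        by (metis add.commute int_pow_mult x)
      have "x [^] ((int m + 1) * a - int m * b) = ?u [^] (m + 1) \<otimes> inv (?v [^] m)"
        by (simp add: int_pow_diff int_pow_pow ac_simps flip: int_pow_int
            del: nat_pow_Suc)
      also have "\<dots> = R ?u ?v" using R_comm uv by simp
      finally have "f (x [^] ((int m + 1) * a - int m * b)) = S (f ?u) (f ?v)"
        using R by simp
      also have "\<dots> = f ?u [^] (n + 1) \<otimes> inv (f ?v [^] n)"
        using S_comm f_comm uv by simp
      finally have *: "\<phi> ((int m + 1) * a - int m * b)
          = f ?u [^] (n + 1) \<otimes> inv (f ?v [^] n) \<otimes> inv c"
        by (simp add: \<phi>_def)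
      have "\<phi> a [^] (n + 1) \<otimes> inv (\<phi> b [^] n)
          = f ?u [^] (n + 1) \<otimes> inv c [^] (n + 1) \<otimes> inv (f ?v [^] n \<otimes> inv c [^] n)"
        by (simp only: \<phi>_def powers int_pow_closed x)
      \<comment> \<open>The exponents \<open>n + 1\<close> and \<open>-n\<close> add up to
        \<open>1\<close>, so one factor \<open>inv c\<close> survives.\<close>
      also have "\<dots> = f ?u [^] (n + 1) \<otimes> (inv c \<otimes> inv (f ?v [^] n))"
        using nat_pow_Suc2[of "inv c" n]
        by (simp add: inv_mult_group m_assoc mult_inv_cancel del: nat_pow_Suc)
      also have "\<dots> = f ?u [^] (n + 1) \<otimes> inv (f ?v [^] n) \<otimes> inv c"
        by (simp add: central[of "inv (f ?v [^] n)"] m_assoc)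
      finally show ?thesis using * by simp
    qed
    have "\<phi> 0 = \<one>" by (simp add: \<phi>_def c_def)
    then have "\<phi> 1 [^] (m * E) = \<phi> 1 [^] (n * E)"
      unfolding E_def by (intro int_affine_pow_eq affine) simp_all
    moreover have "\<phi> 1 = g" using g by (simp add: \<phi>_def fx m_assoc int_pow_1)
    ultimately show ?thesis by simp
  qed
  have "E > 0" using n by (simp add: E_def)
  \<comment> \<open>Either of \<open>m\<close> and \<open>n\<close> may be larger;
    \<open>max\<close> and \<open>min\<close> keep the subtraction of naturals from
    truncating.\<close>
  have "g [^] (max m n * E - min m n * E) = \<one>" if "g \<in> carrier G" for g
    by (rule pow_eq_div2[OF that]) (use eq[OF that] in \<open>auto simp: max_def min_def\<close>)
  moreover have "0 < max m n * E - min m n * E"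
    using \<open>E > 0\<close> mn by (auto simp: max_def min_def)
  ultimately show ?thesis
    unfolding finite_exponent_def by blast
qed

text \<open>An isomorphism respects both maps, so it suffices that one of \<open>R1\<close> and
  \<open>R2\<close> has the formula on commuting pairs.\<close>

lemma singquandle_isomorphic_imp_finite_exponent:
  fixes m n :: nat
  assumes "singquandle_isomorphic (carrier G) (conj_op G) (R1 m) (R2 m)
      (carrier G) (conj_op G) (R1 n) (R2 n)"
    and "R = R1 \<or> R = R2"
    and "\<And>k x y. \<lbrakk>x \<in> carrier G; y \<in> carrier G; x \<otimes> y = y \<otimes> x\<rbrakk> \<Longrightarrow>
      R k x y = x [^] (k + 1) \<otimes> inv (y [^] k)"
    and "1 \<le> n" "m \<noteq> n"
  shows "finite_exponent G"
proof -
  obtain f where f: "bij_betw f (carrier G) (carrier G)"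
    "\<And>x y. \<lbrakk>x \<in> carrier G; y \<in> carrier G\<rbrakk> \<Longrightarrow> f (conj_op G x y) = conj_op G (f x) (f y)"
    "\<And>x y. \<lbrakk>x \<in> carrier G; y \<in> carrier G\<rbrakk> \<Longrightarrow> f (R m x y) = R n (f x) (f y)"
    using assms(1,2) unfolding singquandle_isomorphic_def by auto
  show ?thesis
    by (rule finite_exponentI_conj_op_iso[where R = "R m" and S = "R n"]) (fact f assms(3-5))+
qed

end

text \<open>Non-isomorphism is claimed only without finite exponent: otherwise
  \<open>finite_exponent_imp_isomorphic\<close> gives distinct parameters with isomorphic
  structures.\<close>

theorem proposition4p3:
  fixes G :: "('a, 'b) monoid_scheme"
  assumes "group G" and "\<not> comm_group G"
  shows
    "(\<forall>n::nat. 1 \<le> n \<longrightarrow>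
        oriented_singquandle (carrier G) (conj_op G) (R1_i G n) (R2_i G n) \<and>
        oriented_singquandle (carrier G) (conj_op G) (R1_ii G n) (R2_ii G n) \<and>
        oriented_singquandle (carrier G) (conj_op G) (R1_iii G n) (R2_iii G n)) \<and>
     (\<not> finite_exponent G \<longrightarrow>
      (\<forall>m n::nat. 1 \<le> m \<longrightarrow> 1 \<le> n \<longrightarrow> m \<noteq> n \<longrightarrow>
        \<not> singquandle_isomorphic
            (carrier G) (conj_op G) (R1_i G m) (R2_i G m)
            (carrier G) (conj_op G) (R1_i G n) (R2_i G n) \<and>
        \<not> singquandle_isomorphic
            (carrier G) (conj_op G) (R1_ii G m) (R2_ii G m)
            (carrier G) (conj_op G) (R1_ii G n) (R2_ii G n) \<and>
        \<not> singquandle_isomorphic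
            (carrier G) (conj_op G) (R1_iii G m) (R2_iii G m)
            (carrier G) (conj_op G) (R1_iii G n) (R2_iii G n)))"
proof -
  interpret group G by fact
  have "finite_exponent G"
    if "singquandle_isomorphic (carrier G) (conj_op G) (R1_i G m) (R2_i G m)
      (carrier G) (conj_op G) (R1_i G n) (R2_i G n)" "1 \<le> n" "m \<noteq> n" for m n :: nat
    using that by (intro singquandle_isomorphic_imp_finite_exponent[of "R1_i G" m "R2_i G" n "R1_i G"])
      (simp_all add: R1_i_def commuting_mult_pow)
  moreover have "finite_exponent G"
    if "singquandle_isomorphic (carrier G) (conj_op G) (R1_ii G m) (R2_ii G m)
      (carrier G) (conj_op G) (R1_ii G n) (R2_ii G n)" "1 \<le> n" "m \<noteq> n" for m n :: nat
    using that by (intro singquandle_isomorphic_imp_finite_exponent[of "R1_ii G" m "R2_ii G" n "R1_ii G"])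
      (simp_all add: R1_ii_def commuting_mult_pow)
  moreover have "finite_exponent G"
    if "singquandle_isomorphic (carrier G) (conj_op G) (R1_iii G m) (R2_iii G m)
      (carrier G) (conj_op G) (R1_iii G n) (R2_iii G n)" "1 \<le> n" "m \<noteq> n" for m n :: nat
    using that by (intro singquandle_isomorphic_imp_finite_exponent[of "R1_iii G" m "R2_iii G" n "R2_iii G"])
      (simp_all add: R2_iii_def commuting_mult_pow)
  ultimately show ?thesis
    using oriented_singquandle_i oriented_singquandle_ii oriented_singquandle_iii by blast
qed

end
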